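(* Let $K$ be a field, let $s$ and $l$ be arbitrary positive integers, let $n\ge 1$, and let $\alpha_1,\ldots,\alpha_n$ be integers with $\alpha_i\in\{s,l\}$ for every $i=1,\ldots,n$. Then the integral closure of the ideal $(x_1^{\alpha_1},\ldots,x_n^{\alpha_n})\subset K[x_1,\ldots,x_n]$ is a normal ideal. Equivalently (in the notation where the variables are grouped by exponent): for all positive integers $s\le l$ and all positive integers $m,n$, the ideal $J\subset K[x_1,\ldots,x_m,y_1,\ldots,y_n]$ generated by the monomials $x_{i_1}\cdots x_{i_{s-a}}\,y_{j_1}\cdots y_{j_{\lambda_a}}$ with $a\in\{0,1,\ldots,s\}$, $1\le i_1\le\cdots\le i_{s-a}\le m$, $1\le j_1\le\cdots\le j_{\lambda_a}\le n$, where $\lambda_a=\lceil a l/s\rceil$, is a normal ideal.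
   Context: For an ideal $I$ in a Noetherian commutative ring $R$, the integral closure $\overline{I}$ is the ideal of all $x\in R$ satisfying an equation $x^{p}+a_1x^{p-1}+\cdots+a_{p-1}x+a_p=0$ for some $p\ge 1$ with $a_i\in I^i$ for each $i$. The ideal $I$ is integrally closed if $I=\overline{I}$. An ideal is normal if all of its positive powers are integrally closed. Empty products of variables are equal to $1$. *)

theory Defs
  imports Complex_Main "HOL-Library.Poly_Mapping"
begin

text \<open>
  The ideals of a commutative ring are the submodules of the ring viewed as a module over itself.
\<close>

global_interpretation ring_ideal: module "(*) :: 'a::comm_ring_1 \<Rightarrow> 'a \<Rightarrow> 'a"
  defines is_ideal = ring_ideal.subspace
    and ideal_generated = ring_ideal.span
  by unfold_locales (simp_all add: algebra_simps)

definition ideal_product :: "'a::comm_ring_1 set \<Rightarrow> 'a set \<Rightarrow> 'a set" where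
  "ideal_product I J = ideal_generated {a * b | a b. a \<in> I \<and> b \<in> J}"

primrec ideal_power :: "'a::comm_ring_1 set \<Rightarrow> nat \<Rightarrow> 'a set" where
  "ideal_power I 0 = UNIV"
| "ideal_power I (Suc k) = ideal_product I (ideal_power I k)"

definition integral_closure :: "'a::comm_ring_1 set \<Rightarrow> 'a set" where
  "integral_closure I =
    {x. \<exists>p\<ge>1. \<exists>a :: nat \<Rightarrow> 'a. (\<forall>i\<in>{1..p}. a i \<in> ideal_power I i) \<and>
          x ^ p + (\<Sum>i=1..p. a i * x ^ (p - i)) = 0}"

definition integrally_closed :: "'a::comm_ring_1 set \<Rightarrow> bool" where
  "integrally_closed I \<longleftrightarrow> is_ideal I \<and> integral_closure I = I"

definition normal_ideal :: "'a::comm_ring_1 set \<Rightarrow> bool" where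
  "normal_ideal I \<longleftrightarrow> is_ideal I \<and> (\<forall>k\<ge>1. integrally_closed (ideal_power I k))"

text \<open>
  The polynomial ring over \<open>'k\<close> in variables indexed by \<open>'v\<close>: finitely supported functions
  from exponent vectors to coefficients, with the convolution product of
  \<^theory>\<open>HOL-Library.Poly_Mapping\<close>.
\<close>

type_synonym ('v, 'k) mpoly = "('v \<Rightarrow>\<^sub>0 nat) \<Rightarrow>\<^sub>0 'k"

definition mvar :: "'v \<Rightarrow> ('v, 'k::comm_ring_1) mpoly" where
  "mvar i = Poly_Mapping.single (Poly_Mapping.single i 1) 1"

definition lam :: "nat \<Rightarrow> nat \<Rightarrow> nat \<Rightarrow> nat" where
  "lam s l a = nat \<lceil>real (a * l) / real s\<rceil>"

text \<open>
  The variables \<open>x\<close> and \<open>y\<close> are indexed by the left and the right summand of \<open>'m + 'n\<close>;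
  weakly increasing index sequences are sorted lists.
\<close>

definition grouped_ideal ::
  "nat \<Rightarrow> nat \<Rightarrow> ('m::{finite,linorder} + 'n::{finite,linorder}, 'k::comm_ring_1) mpoly set" where
  "grouped_ideal s l = ideal_generated
    {(\<Prod>i\<leftarrow>is. mvar (Inl i)) * (\<Prod>j\<leftarrow>js. mvar (Inr j)) | a is js.
       a \<in> {0..s} \<and> sorted is \<and> length is = s - a \<and> sorted js \<and> length js = lam s l a}"

end

theory Submission
  imports Defs "HOL-Library.FuncSet" "HOL-Library.Multiset" "HOL-Library.Cardinality"
begin

text \<open>
  Give the variables with exponent \<open>s\<close> weight \<open>l\<close> and those with exponent \<open>l\<close> weight \<open>s\<close>, and
  let \<open>weight_ideal w c\<close> be the ideal of polynomials all of whose terms have weight at least \<open>c\<close>.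
  With \<open>c = s * l\<close> both ideals of the theorem turn out to be of the form \<open>weight_ideal w c\<close>, and what
  has to be shown is that this ideal is normal.

  For any weights, \<open>weight_ideal w c\<close> is integrally closed
  (\<open>integral_closure_subset_weight_ideal\<close>): the least weight of a term behaves like a valuation,
  because the power of a term at an exposed vertex of the Newton polytope cannot be cancelled.

  For normality it remains to see that the \<open>k\<close>-th power of \<open>weight_ideal w c\<close> is
  \<open>weight_ideal w (k * c)\<close>. Here it matters that there are only two weights
  (\<open>two_weight_splits\<close>): a monomial of weight at least \<open>2 * s * l\<close> has degree at least \<open>s\<close> in
  the variables of weight \<open>l\<close> or degree at least \<open>l\<close> in those of weight \<open>s\<close>, so it has a factor
  of weight exactly \<open>s * l\<close>.

  The integral closure of \<open>(x\<^sub>1\<^bsup>\<alpha>\<^sub>1\<^esup>, \<dots>)\<close> contains all of \<open>weight_ideal w c\<close>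
  (\<open>integral_closure_pure_powers\<close>) by the determinant trick: a polynomial of weight at least \<open>c\<close>
  maps the polynomials of large weight into their product with the pure powers. The trick itself is
  \<open>integral_closure_if_stable_module\<close>. The generators of the grouped ideal are the monomials obtained
  by truncating a monomial of sufficient weight to \<open>x\<close>-degree \<open>s - a\<close> and the least admissible
  \<open>y\<close>-degree (\<open>grouped_ideal_eq_weight_ideal\<close>).
\<close>

text \<open>
  The rule below is associativity of the ring multiplication, but oriented to the left and hence in
  conflict with the usual normal forms of \<open>ac_simps\<close> and \<open>algebra_simps\<close>.
\<close>

declare ring_ideal.scale_scale [simp del]

section \<open>Ideals, their products and powers\<close>

lemma ideal_mult:
  assumes "is_ideal I" and "x \<in> I"
  shows "r * x \<in> I"
  using assms by (rule ring_ideal.subspace_scale)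

lemma is_ideal_colon:
  assumes "is_ideal C"
  shows "is_ideal {x. a * x \<in> C}"
  unfolding ring_ideal.subspace_def
proof (intro conjI ballI allI)
  show "0 \<in> {x. a * x \<in> C}"
    using ring_ideal.subspace_0[OF assms] by simp
  show "x + y \<in> {x. a * x \<in> C}" if "x \<in> {x. a * x \<in> C}" "y \<in> {x. a * x \<in> C}" for x y
    using ring_ideal.subspace_add[OF assms] that by (simp add: distrib_left)
  show "c * x \<in> {x. a * x \<in> C}" if "x \<in> {x. a * x \<in> C}" for c x
    using ideal_mult[OF assms, of "a * x" c] that by (simp add: ac_simps)
qed

lemma ideal_generated_mult_closed:
  assumes "is_ideal C" and "x \<in> ideal_generated A" and "y \<in> ideal_generated B"
    and AB: "\<And>a b. a \<in> A \<Longrightarrow> b \<in> B \<Longrightarrow> a * b \<in> C"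
  shows "x * y \<in> C"
proof -
  have "a * y \<in> C" if "a \<in> A" for a
  proof -
    have "ideal_generated B \<subseteq> {y. a * y \<in> C}"
      by (rule ring_ideal.span_minimal) (use AB[OF that] is_ideal_colon[OF assms(1)] in auto)
    then show ?thesis using assms(3) by blast
  qed
  then have "A \<subseteq> {x. y * x \<in> C}"
    by (auto simp: mult.commute)
  then have "ideal_generated A \<subseteq> {x. y * x \<in> C}"
    by (rule ring_ideal.span_minimal) (rule is_ideal_colon[OF assms(1)])
  with assms(2) have "y * x \<in> C" by blast
  then show ?thesis by (simp only: mult.commute)
qed

lemma ideal_product_subset:
  assumes "is_ideal C" and "\<And>a b. a \<in> I \<Longrightarrow> b \<in> J \<Longrightarrow> a * b \<in> C"
  shows "ideal_product I J \<subseteq> C"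
  unfolding ideal_product_def using assms by (intro ring_ideal.span_minimal) auto

lemma mult_in_ideal_product:
  assumes "a \<in> I" and "b \<in> J"
  shows "a * b \<in> ideal_product I J"
  unfolding ideal_product_def using assms by (intro ring_ideal.span_base) auto

lemma is_ideal_ideal_power: "is_ideal (ideal_power I k)"
  by (cases k) (auto simp: ideal_product_def ring_ideal.subspace_span)

lemma ideal_power_one:
  assumes "is_ideal I"
  shows "ideal_power I 1 = I"
proof
  show "ideal_power I 1 \<subseteq> I"
    using ideal_product_subset[OF assms, of I UNIV] ideal_mult[OF assms] by (metis One_nat_def ideal_power.simps mult.commute)
  show "I \<subseteq> ideal_power I 1"
    using mult_in_ideal_product[of _ I 1 UNIV] by fastforce
qed

lemma mult_in_ideal_power:
  assumes "a \<in> ideal_power I i" and "b \<in> ideal_power I j"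
  shows "a * b \<in> ideal_power I (i + j)"
  using assms(1)
proof (induction i arbitrary: a)
  case 0
  then show ?case
    using ideal_mult[OF is_ideal_ideal_power assms(2)] by simp
next
  case (Suc i)
  have "x * y * b \<in> ideal_power I (Suc i + j)" if "x \<in> I" "y \<in> ideal_power I i" for x y
    using mult_in_ideal_product[OF that(1) Suc.IH[OF that(2)]] by (simp add: mult.assoc)
  then have "ideal_power I (Suc i) \<subseteq> {a. b * a \<in> ideal_power I (Suc i + j)}"
    unfolding ideal_power.simps(2)[of I i]
    by (intro ideal_product_subset is_ideal_colon is_ideal_ideal_power) (simp add: mult.commute)
  with Suc.prems have "b * a \<in> ideal_power I (Suc i + j)" by blast
  then show ?case by (simp only: mult.commute)
qed

lemma ideal_subset_integral_closure:
  assumes "is_ideal I"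
  shows "I \<subseteq> integral_closure I"
proof
  fix x assume "x \<in> I"
  then have "- x \<in> ideal_power I 1"
    using assms ideal_power_one ring_ideal.subspace_neg by metis
  then show "x \<in> integral_closure I"
    unfolding integral_closure_def by (intro CollectI exI[of _ 1] exI[of _ "\<lambda>_. - x"]) auto
qed

section \<open>Integrality from a finitely generated module\<close>

text \<open>
  The lower-order part of an equation of integral dependence of degree \<open>e\<close> for \<open>z\<close> over \<open>I\<close>:
  such an equation says precisely that \<open>z ^ e\<close> lies in this ideal. The ideal is a graded piece
  for the grading in which \<open>I\<close> and \<open>z\<close> have degree 1, so tails may be multiplied.
\<close>

definition integral_tail :: "'a::comm_ring_1 set \<Rightarrow> 'a \<Rightarrow> nat \<Rightarrow> 'a set" where
  "integral_tail I z e = ideal_generated {a * z ^ (e - i) | a i. i \<in> {1..e} \<and> a \<in> ideal_power I i}"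

lemma is_ideal_integral_tail: "is_ideal (integral_tail I z e)"
  by (simp add: integral_tail_def ring_ideal.subspace_span)

lemma in_integral_tailI:
  assumes "i \<in> {1..e}" and "a \<in> ideal_power I i"
  shows "a * z ^ (e - i) \<in> integral_tail I z e"
  unfolding integral_tail_def using assms by (intro ring_ideal.span_base) auto

lemma integral_tail_mult:
  assumes "x \<in> integral_tail I z d" and "y \<in> integral_tail I z e"
  shows "x * y \<in> integral_tail I z (d + e)"
proof (rule ideal_generated_mult_closed[OF is_ideal_integral_tail
      assms[unfolded integral_tail_def]])
  fix p q
  assume "p \<in> {a * z ^ (d - i) | a i. i \<in> {1..d} \<and> a \<in> ideal_power I i}"
    and "q \<in> {a * z ^ (e - i) | a i. i \<in> {1..e} \<and> a \<in> ideal_power I i}"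
  then obtain a i b j where *: "p = a * z ^ (d - i)" "i \<in> {1..d}" "a \<in> ideal_power I i"
    "q = b * z ^ (e - j)" "j \<in> {1..e}" "b \<in> ideal_power I j"
    by blast
  then have "d - i + (e - j) = d + e - (i + j)" by auto
  then have "p * q = a * b * z ^ (d + e - (i + j))"
    using * by (metis mult.assoc mult.left_commute power_add)
  then show "p * q \<in> integral_tail I z (d + e)"
    using in_integral_tailI[OF _ mult_in_ideal_power[OF *(3) *(6)], of "d + e" z] *(2,5) by auto
qed

lemma integral_tail_power_mult:
  assumes "y \<in> integral_tail I z e"
  shows "z ^ d * y \<in> integral_tail I z (d + e)"
proof -
  have "z ^ d * (a * z ^ (e - i)) \<in> integral_tail I z (d + e)"
    if "i \<in> {1..e}" "a \<in> ideal_power I i" for a i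
  proof -
    have "z ^ d * (a * z ^ (e - i)) = a * z ^ (d + e - i)"
      using that(1) by (metis Nat.add_diff_assoc atLeastAtMost_iff mult.left_commute power_add)
    then show ?thesis using in_integral_tailI[of i "d + e" a I z] that by auto
  qed
  then have "integral_tail I z e \<subseteq> {y. z ^ d * y \<in> integral_tail I z (d + e)}"
    unfolding integral_tail_def[of I z e]
    by (intro ring_ideal.span_minimal is_ideal_colon is_ideal_integral_tail) auto
  then show ?thesis using assms by blast
qed

text \<open>
  Each power of \<open>I\<close> is an ideal, so a sum of generators of the tail may be collected by exponent;
  this turns membership into an explicit equation.
\<close>

lemma integral_closureI:
  assumes "p \<ge> 1" and "z ^ p \<in> integral_tail I z p"
  shows "z \<in> integral_closure I"
proof -
  let ?T = "{y. \<exists>a. (\<forall>i\<in>{1..p}. a i \<in> ideal_power I i) \<and> y = (\<Sum>i=1..p. a i * z ^ (p - i))}"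
  note ideal = is_ideal_ideal_power[of I]
  have "is_ideal ?T"
    unfolding ring_ideal.subspace_def
  proof (intro conjI ballI allI)
    show "0 \<in> ?T"
      using ring_ideal.subspace_0[OF ideal] by (intro CollectI exI[of _ "\<lambda>_. 0"]) auto
  next
    fix x y assume "x \<in> ?T" "y \<in> ?T"
    obtain a where "\<forall>i\<in>{1..p}. a i \<in> ideal_power I i" "x = (\<Sum>i=1..p. a i * z ^ (p - i))"
      using \<open>x \<in> ?T\<close> by blast
    moreover obtain b where "\<forall>i\<in>{1..p}. b i \<in> ideal_power I i" "y = (\<Sum>i=1..p. b i * z ^ (p - i))"
      using \<open>y \<in> ?T\<close> by blast
    ultimately show "x + y \<in> ?T"
      using ring_ideal.subspace_add[OF ideal]
      by (intro CollectI exI[of _ "\<lambda>i. a i + b i"]) (auto simp: distrib_right sum.distrib)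
  next
    fix c x assume "x \<in> ?T"
    then obtain a where "\<forall>i\<in>{1..p}. a i \<in> ideal_power I i" "x = (\<Sum>i=1..p. a i * z ^ (p - i))"
      by blast
    then show "c * x \<in> ?T"
      using ideal_mult[OF ideal]
      by (intro CollectI exI[of _ "\<lambda>i. c * a i"]) (auto simp: sum_distrib_left mult.assoc)
  qed
  moreover have "{a * z ^ (p - i) | a i. i \<in> {1..p} \<and> a \<in> ideal_power I i} \<subseteq> ?T"
  proof safe
    fix a i assume i: "i \<in> {1..p}" "a \<in> ideal_power I i"
    have "a * z ^ (p - i) = (\<Sum>j=1..p. if j = i then a * z ^ (p - i) else 0)"
      using i by (simp add: sum.delta)
    also have "\<dots> = (\<Sum>j=1..p. (if j = i then a else 0) * z ^ (p - j))"
      by (rule sum.cong) auto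
    finally show "\<exists>b. (\<forall>j\<in>{1..p}. b j \<in> ideal_power I j) \<and>
        a * z ^ (p - i) = (\<Sum>j=1..p. b j * z ^ (p - j))"
      using i ring_ideal.subspace_0[OF ideal] by (intro exI[of _ "\<lambda>j. if j = i then a else 0"]) auto
  qed
  ultimately have "integral_tail I z p \<subseteq> ?T"
    unfolding integral_tail_def by (intro ring_ideal.span_minimal)
  then have "z ^ p \<in> ?T" using assms(2) by blast
  then obtain a where a: "\<forall>i\<in>{1..p}. a i \<in> ideal_power I i" "z ^ p = (\<Sum>i=1..p. a i * z ^ (p - i))"
    by blast
  have "z ^ p + (\<Sum>i=1..p. - a i * z ^ (p - i)) = 0"
    using a(2) by (simp add: sum_negf)
  then show ?thesis
    unfolding integral_closure_def using a(1) assms(1) ring_ideal.subspace_neg[OF ideal]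
    by (intro CollectI exI[of _ p] conjI exI[of _ "\<lambda>i. - a i"]) auto
qed

text \<open>
  The determinant trick, carried out by eliminating one module generator after the other. If
  \<open>d * v n\<close> is expressed through the \<open>v j\<close> with matrix \<open>A\<close>, then \<open>d - A n n\<close> maps \<open>v n\<close> into
  the span of the remaining generators, so multiplying the other relations by \<open>d - A n n\<close>
  eliminates \<open>v n\<close>. Homogeneity is what makes this work: the multiplier stays congruent to
  a power of \<open>z\<close> modulo the tail of the same degree, and the new coefficients stay in that tail.
\<close>

lemma monic_annihilator:
  fixes v :: "'i \<Rightarrow> 'a::comm_ring_1"
  assumes "finite B" and "e \<ge> 1" and "d - z ^ e \<in> integral_tail I z e"
    and "\<And>b. b \<in> B \<Longrightarrow> \<exists>A. (\<forall>j\<in>B. A j \<in> integral_tail I z e) \<and> d * v b = (\<Sum>j\<in>B. A j * v j)"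
  shows "\<exists>p\<ge>1. \<exists>y. y - z ^ p \<in> integral_tail I z p \<and> (\<forall>b\<in>B. y * v b = 0)"
  using assms
proof (induction B arbitrary: d e rule: finite_induct)
  case empty
  then show ?case by auto
next
  case (insert n B)
  note tail = is_ideal_integral_tail[of I z]
  let ?P = "\<lambda>b a. (\<forall>j\<in>insert n B. a j \<in> integral_tail I z e) \<and> d * v b = (\<Sum>j\<in>insert n B. a j * v j)"
  define A where "A b = (SOME a. ?P b a)" for b
  have P: "?P b (A b)" if "b \<in> insert n B" for b
    unfolding A_def by (rule someI_ex[of "?P b", OF insert.prems(3)[OF that]])
  have A: "A b j \<in> integral_tail I z e" if "b \<in> insert n B" "j \<in> insert n B" for b j
    using P[OF that(1)] that(2) by blast
  have dv: "d * v b = (\<Sum>j\<in>insert n B. A b j * v j)" if "b \<in> insert n B" for b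
    using P[OF that] by blast
  define q where "q = d - A n n"
  have q: "q - z ^ e \<in> integral_tail I z e"
    using ring_ideal.subspace_diff[OF tail insert.prems(2) A[of n n]] by (simp add: q_def algebra_simps)
  have q_mult: "q * y \<in> integral_tail I z (e + k)" if "y \<in> integral_tail I z k" for y k
  proof -
    have "q * y = (q - z ^ e) * y + z ^ e * y" by (simp add: algebra_simps)
    then show ?thesis
      using ring_ideal.subspace_add[OF tail integral_tail_mult[OF q that] integral_tail_power_mult[OF that]]
      by simp
  qed
  have q_mult_monic: "q * y - z ^ (e + k) \<in> integral_tail I z (e + k)"
    if "y - z ^ k \<in> integral_tail I z k" for y k
  proof -
    have "q * y - z ^ (e + k) = q * (y - z ^ k) + z ^ k * (q - z ^ e)"
      by (simp add: algebra_simps power_add)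
    then show ?thesis
      using ring_ideal.subspace_add[OF tail q_mult[OF that] integral_tail_power_mult[OF q, of k, unfolded add.commute[of k]]]
      by simp
  qed
  have qn: "q * v n = (\<Sum>j\<in>B. A n j * v j)"
    using dv[of n] insert.hyps by (simp add: q_def left_diff_distrib)
  have "\<exists>p\<ge>1. \<exists>y. y - z ^ p \<in> integral_tail I z p \<and> (\<forall>b\<in>B. y * v b = 0)"
  proof (rule insert.IH)
    show "e + e \<ge> 1" using insert.prems(1) by simp
    show "q * d - z ^ (e + e) \<in> integral_tail I z (e + e)"
      using q_mult_monic[OF insert.prems(2)] .
    fix b assume b: "b \<in> B"
    have "q * d * v b = q * (A b n * v n + (\<Sum>j\<in>B. A b j * v j))"
      using dv[of b] b insert.hyps by (simp add: mult.assoc)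
    also have "\<dots> = A b n * (q * v n) + (\<Sum>j\<in>B. q * A b j * v j)"
      by (simp add: algebra_simps sum_distrib_left)
    also have "\<dots> = (\<Sum>j\<in>B. (A b n * A n j + q * A b j) * v j)"
      by (simp add: qn sum_distrib_left sum.distrib algebra_simps)
    finally have "q * d * v b = (\<Sum>j\<in>B. (A b n * A n j + q * A b j) * v j)" .
    moreover have "A b n * A n j + q * A b j \<in> integral_tail I z (e + e)" if "j \<in> B" for j
      using that b by (intro ring_ideal.subspace_add[OF tail] integral_tail_mult q_mult A) auto
    ultimately show "\<exists>A. (\<forall>j\<in>B. A j \<in> integral_tail I z (e + e)) \<and>
        q * d * v b = (\<Sum>j\<in>B. A j * v j)"
      by (intro exI[of _ "\<lambda>j. A b n * A n j + q * A b j"]) auto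
  qed
  then obtain p y where y: "p \<ge> 1" "y - z ^ p \<in> integral_tail I z p" "\<forall>b\<in>B. y * v b = 0"
    by (elim exE conjE) (rule that)
  have "q * y * v n = y * (q * v n)" by (simp add: ac_simps)
  also have "\<dots> = (\<Sum>j\<in>B. A n j * (y * v j))"
    by (simp add: qn sum_distrib_left ac_simps)
  finally have "q * y * v n = (\<Sum>j\<in>B. A n j * (y * v j))" .
  then have "q * y * v b = 0" if "b \<in> insert n B" for b
    using that y(3) by (auto simp: mult.assoc)
  then show ?case
    using q_mult_monic[OF y(2)] y(1) by (intro exI[of _ "e + p"] conjI exI[of _ "q * y"]) auto
qed

text \<open>
  Cancellability of one generator makes the module faithful, so that the
  annihilator is zero and the monic relation becomes an equation for \<open>z\<close>.
\<close>

lemma integral_closure_if_stable_module: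
  fixes v :: "'i \<Rightarrow> 'a::comm_ring_1"
  assumes "is_ideal I" and "finite B" and "b0 \<in> B" and "\<And>y. y * v b0 = 0 \<Longrightarrow> y = 0"
    and "\<And>b. b \<in> B \<Longrightarrow> \<exists>A. (\<forall>j\<in>B. A j \<in> I) \<and> z * v b = (\<Sum>j\<in>B. A j * v j)"
  shows "z \<in> integral_closure I"
proof -
  have I: "I \<subseteq> integral_tail I z 1"
    using in_integral_tailI[of 1 1 _ I z] ideal_power_one[OF assms(1)] by auto
  have "\<exists>p\<ge>1. \<exists>y. y - z ^ p \<in> integral_tail I z p \<and> (\<forall>b\<in>B. y * v b = 0)"
  proof (rule monic_annihilator[OF assms(2)])
    show "(1::nat) \<ge> 1" by simp
    show "z - z ^ 1 \<in> integral_tail I z 1"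
      using ring_ideal.subspace_0[OF is_ideal_integral_tail] by simp
    fix b assume "b \<in> B"
    then show "\<exists>A. (\<forall>j\<in>B. A j \<in> integral_tail I z 1) \<and> z * v b = (\<Sum>j\<in>B. A j * v j)"
      using assms(5)[of b] I by (meson subsetD)
  qed
  then obtain p y where y: "p \<ge> 1" "y - z ^ p \<in> integral_tail I z p" "y * v b0 = 0"
    using assms(3) by blast
  then have "y = 0" using assms(4) by blast
  then have "z ^ p \<in> integral_tail I z p"
    using ring_ideal.subspace_neg[OF is_ideal_integral_tail y(2)] by simp
  then show ?thesis using integral_closureI[OF y(1)] by blast
qed

section \<open>Monomials and weights\<close>

abbreviation monomial :: "('v \<Rightarrow>\<^sub>0 nat) \<Rightarrow> ('v, 'k::comm_ring_1) mpoly" where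
  "monomial u \<equiv> Poly_Mapping.single u 1"

lemma monomial_add: "monomial (u + v) = monomial u * monomial v"
  by (simp add: mult_single)

lemma mvar_power: "mvar i ^ a = monomial (Poly_Mapping.single i a)"
  by (induction a) (simp_all add: mvar_def mult_single single_add[symmetric] single_one[symmetric] del: single_one)

lemma prod_list_mvar: "(\<Prod>i\<leftarrow>xs. mvar (g i)) = monomial (\<Sum>i\<leftarrow>xs. Poly_Mapping.single (g i) 1)"
  by (induction xs) (simp_all add: mvar_def mult_single single_one[symmetric] del: single_one)

lemma mpoly_eq_sum_monomials:
  "f = (\<Sum>u\<in>Poly_Mapping.keys f. Poly_Mapping.single u (Poly_Mapping.lookup f u))"
  by (rule poly_mapping_eqI) (auto simp: lookup_sum lookup_single when_def in_keys_iff)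

lemma mpoly_in_ideal:
  assumes "is_ideal I" and "\<And>u. u \<in> Poly_Mapping.keys f \<Longrightarrow> monomial u \<in> I"
  shows "f \<in> I"
proof -
  have "Poly_Mapping.single u a \<in> I" if "u \<in> Poly_Mapping.keys f" for u a
    using ideal_mult[OF assms(1) assms(2)[OF that], of "Poly_Mapping.single 0 a"]
    by (simp add: mult_single)
  then have "(\<Sum>u\<in>Poly_Mapping.keys f. Poly_Mapping.single u (Poly_Mapping.lookup f u)) \<in> I"
    by (intro ring_ideal.subspace_sum[OF assms(1)])
  then show ?thesis by (simp add: mpoly_eq_sum_monomials[symmetric])
qed

lemma mult_monomial_eq_0:
  assumes "f * monomial b = 0"
  shows "f = 0"
proof (rule poly_mapping_eqI)
  fix u
  have "f * monomial b = (\<Sum>v\<in>Poly_Mapping.keys f. Poly_Mapping.single (v + b) (Poly_Mapping.lookup f v))"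
    by (subst mpoly_eq_sum_monomials[of f]) (simp add: sum_distrib_right mult_single)
  then have "0 = Poly_Mapping.lookup
      (\<Sum>v\<in>Poly_Mapping.keys f. Poly_Mapping.single (v + b) (Poly_Mapping.lookup f v)) (u + b)"
    using assms by simp
  also have "\<dots> = Poly_Mapping.lookup f u"
    by (auto simp: lookup_sum lookup_single when_def in_keys_iff)
  finally show "Poly_Mapping.lookup f u = Poly_Mapping.lookup 0 u" by simp
qed

lemma exponent_split:
  fixes u :: "'v \<Rightarrow>\<^sub>0 nat"
  assumes "a \<le> Poly_Mapping.lookup u i"
  shows "u = Poly_Mapping.single i a + (u - Poly_Mapping.single i a)"
  using assms by (intro poly_mapping_eqI) (auto simp: lookup_add lookup_minus lookup_single when_def)

lemma finite_bounded_exponents: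
  "finite {u :: 'v::finite \<Rightarrow>\<^sub>0 nat. \<forall>i. Poly_Mapping.lookup u i \<le> M}"
proof (rule inj_on_finite)
  show "inj_on Poly_Mapping.lookup {u :: 'v \<Rightarrow>\<^sub>0 nat. \<forall>i. Poly_Mapping.lookup u i \<le> M}"
    by (intro inj_onI poly_mapping_eqI) simp
  show "Poly_Mapping.lookup ` {u :: 'v \<Rightarrow>\<^sub>0 nat. \<forall>i. Poly_Mapping.lookup u i \<le> M} \<subseteq> (\<Pi>\<^sub>E i\<in>UNIV. {..M})"
    by auto
  show "finite (\<Pi>\<^sub>E i\<in>(UNIV :: 'v set). {..M})"
    by (intro finite_PiE) auto
qed

definition weight :: "('v::finite \<Rightarrow> nat) \<Rightarrow> ('v \<Rightarrow>\<^sub>0 nat) \<Rightarrow> nat" where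
  "weight w u = (\<Sum>i\<in>UNIV. w i * Poly_Mapping.lookup u i)"

lemma weight_add: "weight w (u + v) = weight w u + weight w v"
  by (simp add: weight_def lookup_add distrib_left sum.distrib)

lemma weight_zero [simp]: "weight w 0 = 0"
  by (simp add: weight_def)

lemma weight_single [simp]: "weight w (Poly_Mapping.single i a) = w i * a"
  by (simp add: weight_def lookup_single when_def if_distrib[of "(*) _"] cong: if_cong)

definition weight_ideal :: "('v::finite \<Rightarrow> nat) \<Rightarrow> nat \<Rightarrow> ('v, 'k::comm_ring_1) mpoly set" where
  "weight_ideal w c = {f. \<forall>u\<in>Poly_Mapping.keys f. c \<le> weight w u}"

lemma weight_ideal_mult:
  assumes "f \<in> weight_ideal w c" and "g \<in> weight_ideal w d"
  shows "f * g \<in> weight_ideal w (c + d)"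
  using assms keys_mult[of f g] unfolding weight_ideal_def
  by (fastforce simp: weight_add intro: add_mono)

lemma weight_ideal_zero [simp]: "weight_ideal w 0 = UNIV"
  by (simp add: weight_ideal_def)

lemma is_ideal_weight_ideal: "is_ideal (weight_ideal w c)"
  unfolding ring_ideal.subspace_def
proof (intro conjI ballI allI)
  show "0 \<in> weight_ideal w c" by (simp add: weight_ideal_def)
  show "f + g \<in> weight_ideal w c" if "f \<in> weight_ideal w c" "g \<in> weight_ideal w c" for f g
    using that Poly_Mapping.keys_add[of f g] by (auto simp: weight_ideal_def)
  show "r * f \<in> weight_ideal w c" if "f \<in> weight_ideal w c" for r f
    using weight_ideal_mult[of r w 0 f c] that by simp
qed

lemma weight_ideal_antimono: "c \<le> d \<Longrightarrow> weight_ideal w d \<subseteq> weight_ideal w c"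
  by (auto simp: weight_ideal_def)

lemma single_in_weight_ideal: "c \<le> weight w u \<Longrightarrow> Poly_Mapping.single u a \<in> weight_ideal w c"
  by (simp add: weight_ideal_def)

lemma weight_ideal_subset:
  assumes "is_ideal I" and "\<And>u. c \<le> weight w u \<Longrightarrow> monomial u \<in> I"
  shows "weight_ideal w c \<subseteq> I"
  using mpoly_in_ideal[OF assms(1)] assms(2) unfolding weight_ideal_def by blast

lemma power_in_weight_ideal:
  assumes "f \<in> weight_ideal w c"
  shows "f ^ k \<in> weight_ideal w (k * c)"
  by (induction k) (simp_all add: weight_ideal_mult assms)

lemma ideal_power_subset_weight_ideal:
  assumes "I \<subseteq> weight_ideal w c"
  shows "ideal_power I k \<subseteq> weight_ideal w (k * c)"
proof (induction k)
  case (Suc k)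
  then show ?case
    using assms weight_ideal_mult[of _ w c _ "k * c"]
    by (simp only: ideal_power.simps mult_Suc, intro ideal_product_subset is_ideal_weight_ideal) blast
qed simp

section \<open>Ideals of bounded weight are integrally closed\<close>

text \<open>
  A generic perturbation of \<open>w\<close> takes its minimum on \<open>S\<close> only once, at a vertex of the Newton
  polytope if \<open>S\<close> is the set of exponents of a polynomial. The perturbation is built
  one variable at a time: the current weight is scaled up so far that adding the next coordinate
  breaks ties only.
\<close>

lemma exposed_exponent:
  fixes S :: "('v::finite \<Rightarrow>\<^sub>0 nat) set"
  assumes "S \<noteq> {}"
  obtains w' u0 where "u0 \<in> S" and "\<And>u. u \<in> S \<Longrightarrow> weight w u0 \<le> weight w u"
    and "\<And>u. u \<in> S \<Longrightarrow> u \<noteq> u0 \<Longrightarrow> weight w' u0 < weight w' u"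
proof -
  have "\<exists>w' u0. u0 \<in> S \<and> (\<forall>u\<in>S. weight w u0 \<le> weight w u \<and> weight w' u0 \<le> weight w' u \<and>
      (weight w' u = weight w' u0 \<longrightarrow> weight w u = weight w u0 \<and>
        (\<forall>i\<in>V. Poly_Mapping.lookup u i = Poly_Mapping.lookup u0 i)))"
    if "finite V" for V
    using that
  proof (induction V)
    case empty
    obtain v where "v \<in> S" using assms by blast
    then obtain u0 where "u0 \<in> S" "\<forall>u. u \<in> S \<longrightarrow> weight w u0 \<le> weight w u"
      using ex_has_least_nat[of "\<lambda>u. u \<in> S" v "weight w"] by blast
    then show ?case by (intro exI[of _ w] exI[of _ u0]) auto
  next
    case (insert i V)
    then obtain w' u0 where u0: "u0 \<in> S"
      and w: "\<And>u. u \<in> S \<Longrightarrow> weight w u0 \<le> weight w u"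
      and w': "\<And>u. u \<in> S \<Longrightarrow> weight w' u0 \<le> weight w' u"
      and tie: "\<And>u. u \<in> S \<Longrightarrow> weight w' u = weight w' u0 \<Longrightarrow> weight w u = weight w u0 \<and>
        (\<forall>i\<in>V. Poly_Mapping.lookup u i = Poly_Mapping.lookup u0 i)"
      by blast
    obtain u1 where u1: "u1 \<in> S" "weight w' u1 = weight w' u0"
      and min: "\<And>u. u \<in> S \<Longrightarrow> weight w' u = weight w' u0 \<Longrightarrow>
        Poly_Mapping.lookup u1 i \<le> Poly_Mapping.lookup u i"
      using ex_has_least_nat[of "\<lambda>u. u \<in> S \<and> weight w' u = weight w' u0" u0 "\<lambda>u. Poly_Mapping.lookup u i"] u0
      by blast
    \<comment> \<open>A scaled step in \<open>w'\<close> outweighs the coordinate \<open>i\<close> of \<open>u1\<close>.\<close>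
    define N where "N = Poly_Mapping.lookup u1 i + 1"
    define w'' where "w'' j = N * w' j + (if j = i then 1 else 0)" for j
    have w''_eq: "weight w'' u = N * weight w' u + Poly_Mapping.lookup u i" for u
      by (simp add: weight_def w''_def distrib_right sum.distrib sum_distrib_left mult.assoc
          if_distrib[of "\<lambda>x. x * _"] cong: if_cong)
    have less: "weight w'' u1 < weight w'' u" if "u \<in> S" "weight w' u \<noteq> weight w' u0" for u
    proof -
      have "weight w' u1 + 1 \<le> weight w' u"
        using w'[OF that(1)] that(2) u1(2) by simp
      then have "N * (weight w' u1 + 1) \<le> N * weight w' u" by (rule mult_le_mono2)
      then show ?thesis by (simp add: w''_eq N_def)
    qed
    have "weight w u1 \<le> weight w u \<and> weight w'' u1 \<le> weight w'' u \<and>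
      (weight w'' u = weight w'' u1 \<longrightarrow> weight w u = weight w u1 \<and>
        (\<forall>j\<in>insert i V. Poly_Mapping.lookup u j = Poly_Mapping.lookup u1 j))" if "u \<in> S" for u
    proof (cases "weight w' u = weight w' u0")
      case True
      then show ?thesis
        using tie[OF that True] tie[OF u1] min[OF that True] u1(2) by (auto simp: w''_eq)
    next
      case False
      then show ?thesis
        using less[OF that False] w[OF that] tie[OF u1] by auto
    qed
    then show ?case
      using u1(1) by (intro exI[of _ w''] exI[of _ u1]) blast
  qed
  from this[of UNIV] obtain w' u0 where "u0 \<in> S" "\<forall>u\<in>S. weight w u0 \<le> weight w u"
    "\<forall>u\<in>S. weight w' u0 \<le> weight w' u"
    and "\<forall>u\<in>S. weight w' u = weight w' u0 \<longrightarrow> (\<forall>i. Poly_Mapping.lookup u i = Poly_Mapping.lookup u0 i)"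
    by auto
  then show thesis
    using that by (metis le_neq_implies_less poly_mapping_eqI)
qed

text \<open>
  No other product of \<open>p\<close> terms of \<open>f\<close> can cancel the \<open>p\<close>-th power of the term at an exposed
  exponent, since all of them have larger \<open>w'\<close>-weight.
\<close>

lemma exposed_exponent_power:
  fixes f :: "('v::finite, 'k::idom) mpoly"
  assumes "u0 \<in> Poly_Mapping.keys f"
    and "\<And>u. u \<in> Poly_Mapping.keys f \<Longrightarrow> u \<noteq> u0 \<Longrightarrow> weight w' u0 < weight w' u"
  obtains m where "m \<in> Poly_Mapping.keys (f ^ p)" and "\<And>w. weight w m = p * weight w u0"
proof -
  define a d where "a = Poly_Mapping.lookup f u0" and "d = weight w' u0"
  define z where "z = Poly_Mapping.single u0 a"
  have "a \<noteq> 0" using assms(1) by (simp add: a_def in_keys_iff)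
  have z: "z \<in> weight_ideal w' d"
    unfolding z_def by (rule single_in_weight_ideal) (simp add: d_def)
  have f: "f \<in> weight_ideal w' d"
    using assms(2) unfolding weight_ideal_def d_def by (auto intro: less_imp_le)
  have diff: "f - z \<in> weight_ideal w' (d + 1)"
  proof -
    have "u \<in> Poly_Mapping.keys f \<and> u \<noteq> u0" if "u \<in> Poly_Mapping.keys (f - z)" for u
      using that by (cases "u = u0") (auto simp: in_keys_iff lookup_minus z_def a_def lookup_single)
    then show ?thesis
      using assms(2) unfolding weight_ideal_def d_def by fastforce
  qed
  have diff_power: "f ^ k - z ^ k \<in> weight_ideal w' (k * d + 1)" for k
  proof (induction k)
    case 0
    then show ?case by (simp add: ring_ideal.subspace_0[OF is_ideal_weight_ideal])
  next
    case (Suc k)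
    have "f ^ Suc k - z ^ Suc k = f * (f ^ k - z ^ k) + (f - z) * z ^ k"
      by (simp add: algebra_simps)
    moreover have "f * (f ^ k - z ^ k) \<in> weight_ideal w' (Suc k * d + 1)"
      using weight_ideal_mult[OF f Suc] by (simp add: ac_simps)
    moreover have "(f - z) * z ^ k \<in> weight_ideal w' (Suc k * d + 1)"
      using weight_ideal_mult[OF diff power_in_weight_ideal[OF z, of k]] by (simp add: ac_simps)
    ultimately show ?case
      using ring_ideal.subspace_add[OF is_ideal_weight_ideal] by metis
  qed
  have "\<exists>m. z ^ k = Poly_Mapping.single m (a ^ k) \<and> (\<forall>w. weight w m = k * weight w u0)" for k
  proof (induction k)
    case 0
    then show ?case by (intro exI[of _ 0]) simp
  next
    case (Suc k)
    then obtain m where "z ^ k = Poly_Mapping.single m (a ^ k)" "\<forall>w. weight w m = k * weight w u0"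
      by blast
    then show ?case
      by (intro exI[of _ "u0 + m"]) (simp add: z_def mult_single weight_add)
  qed
  then obtain m where m: "z ^ p = Poly_Mapping.single m (a ^ p)" "\<And>w. weight w m = p * weight w u0"
    by blast
  have "m \<notin> Poly_Mapping.keys (f ^ p - z ^ p)"
    using diff_power[of p] m(2)[of w'] unfolding weight_ideal_def d_def by fastforce
  then have "Poly_Mapping.lookup (f ^ p) m = a ^ p"
    by (simp add: in_keys_iff lookup_minus m(1))
  then have "m \<in> Poly_Mapping.keys (f ^ p)"
    using \<open>a \<noteq> 0\<close> by (simp add: in_keys_iff)
  then show thesis using that m(2) by blast
qed

text \<open>
  If the least weight \<open>d\<close> of a term of \<open>x\<close> were below \<open>c\<close>, then \<open>x ^ p\<close> would have a term of
  weight \<open>p * d\<close>, whereas the term \<open>a i * x ^ (p - i)\<close> of an integral equation has weight at least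
  \<open>i * c + (p - i) * d\<close>.
\<close>

lemma integral_closure_subset_weight_ideal:
  fixes I :: "('v::finite, 'k::idom) mpoly set"
  assumes "I \<subseteq> weight_ideal w c"
  shows "integral_closure I \<subseteq> weight_ideal w c"
proof (rule subsetI, rule ccontr)
  fix x assume "x \<in> integral_closure I" and "x \<notin> weight_ideal w c"
  from this(1) obtain p a where a: "\<forall>i\<in>{1..p}. a i \<in> ideal_power I i"
    and eq: "x ^ p + (\<Sum>i=1..p. a i * x ^ (p - i)) = 0"
    unfolding integral_closure_def by blast
  from \<open>x \<notin> weight_ideal w c\<close> obtain u where u: "u \<in> Poly_Mapping.keys x" "weight w u < c"
    unfolding weight_ideal_def by (auto simp: not_le)
  obtain w' u0 where u0: "u0 \<in> Poly_Mapping.keys x"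
    and w: "\<And>u. u \<in> Poly_Mapping.keys x \<Longrightarrow> weight w u0 \<le> weight w u"
    and w': "\<And>u. u \<in> Poly_Mapping.keys x \<Longrightarrow> u \<noteq> u0 \<Longrightarrow> weight w' u0 < weight w' u"
    using exposed_exponent[of "Poly_Mapping.keys x" w] u(1) by (metis empty_iff)
  define d where "d = weight w u0"
  have "d < c" using w[OF u(1)] u(2) by (simp add: d_def)
  have x: "x \<in> weight_ideal w d" using w by (simp add: weight_ideal_def d_def)
  have "a i * x ^ (p - i) \<in> weight_ideal w (p * d + 1)" if i: "i \<in> {1..p}" for i
  proof -
    have "p * d + 1 \<le> i * c + (p - i) * d"
    proof -
      have "p * d = i * d + (p - i) * d" using i by (simp add: add_mult_distrib[symmetric])
      moreover have "i * d < i * c" using i \<open>d < c\<close> by simp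
      ultimately show ?thesis by linarith
    qed
    moreover have "a i * x ^ (p - i) \<in> weight_ideal w (i * c + (p - i) * d)"
      using weight_ideal_mult[OF _ power_in_weight_ideal[OF x]] bspec[OF a i] ideal_power_subset_weight_ideal[OF assms]
      by blast
    ultimately show ?thesis using weight_ideal_antimono by blast
  qed
  then have "(\<Sum>i=1..p. a i * x ^ (p - i)) \<in> weight_ideal w (p * d + 1)"
    by (intro ring_ideal.subspace_sum[OF is_ideal_weight_ideal])
  then have "- (\<Sum>i=1..p. a i * x ^ (p - i)) \<in> weight_ideal w (p * d + 1)"
    by (rule ring_ideal.subspace_neg[OF is_ideal_weight_ideal])
  moreover have "x ^ p = - (\<Sum>i=1..p. a i * x ^ (p - i))"
    using eq by (simp only: eq_neg_iff_add_eq_0)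
  ultimately have "x ^ p \<in> weight_ideal w (p * d + 1)" by (simp only:)
  moreover obtain m where "m \<in> Poly_Mapping.keys (x ^ p)" "weight w m = p * d"
    using exposed_exponent_power[OF u0 w'] unfolding d_def by metis
  ultimately show False by (fastforce simp: weight_ideal_def)
qed

lemma integrally_closed_weight_ideal:
  "integrally_closed (weight_ideal w c :: ('v::finite, 'k::idom) mpoly set)"
  unfolding integrally_closed_def
  using integral_closure_subset_weight_ideal[OF order_refl] ideal_subset_integral_closure
    is_ideal_weight_ideal by blast

section \<open>The integral closure of an ideal of pure powers\<close>

text \<open>
  The use of this is that, for positive weights, \<open>weight_ideal w c\<close> is generated by the finitely many
  monomials in it with exponents at most \<open>c\<close>. Once an exponent reaches \<open>c\<close>, that variable
  alone supplies enough weight.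
\<close>

lemma bounded_divisor_of_large_weight:
  fixes w :: "'v::finite \<Rightarrow> nat"
  assumes "\<And>i. w i > 0" and "c \<le> weight w u"
  obtains b t where "u = b + t" and "c \<le> weight w b" and "\<And>i. Poly_Mapping.lookup b i \<le> c"
proof (cases "\<exists>i. c \<le> Poly_Mapping.lookup u i")
  case True
  then obtain i where i: "c \<le> Poly_Mapping.lookup u i" by blast
  show thesis
    by (rule that[OF exponent_split[OF i]]) (use assms(1)[of i] in \<open>simp_all add: lookup_single when_def\<close>)
next
  case False
  then show thesis
    using that[of u 0] assms(2) by (simp add: not_le less_imp_le)
qed

text \<open>
  By the pigeonhole principle one of the variables contributes at least \<open>c\<close> to the weight, so that
  its exponent in \<open>u\<close> is at least that of its pure power.
\<close>

lemma pure_power_divides: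
  fixes w :: "'v::finite \<Rightarrow> nat"
  assumes "c > 0" and "\<And>i. w i * \<alpha> i = c" and "c * CARD('v) + c \<le> weight w u"
  obtains i t where "u = Poly_Mapping.single i (\<alpha> i) + t" and "c * CARD('v) \<le> weight w t"
proof -
  have "\<exists>i. \<alpha> i \<le> Poly_Mapping.lookup u i"
  proof (rule ccontr)
    assume "\<nexists>i. \<alpha> i \<le> Poly_Mapping.lookup u i"
    then have "w i * Poly_Mapping.lookup u i \<le> c" for i
      using assms(2)[of i] mult_le_mono2[of "Poly_Mapping.lookup u i" "\<alpha> i" "w i"]
      by (simp add: not_le less_imp_le)
    then have "weight w u \<le> CARD('v) * c"
      unfolding weight_def using sum_bounded_above[of UNIV "\<lambda>i. w i * Poly_Mapping.lookup u i" c] by simp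
    then show False using assms(1,3) by (simp add: mult.commute)
  qed
  then obtain i where i: "\<alpha> i \<le> Poly_Mapping.lookup u i" by blast
  then have "weight w u = c + weight w (u - Poly_Mapping.single i (\<alpha> i))"
    using assms(2) weight_add[of w "Poly_Mapping.single i (\<alpha> i)" "u - Poly_Mapping.single i (\<alpha> i)"]
    by (simp flip: exponent_split)
  then show thesis
    using that[OF exponent_split[OF i]] assms(3) by simp
qed

text \<open>
  For \<open>f\<close> of weight at least \<open>c\<close>, multiplication by \<open>f\<close> maps the polynomials of weight at least
  \<open>K = c * n\<close>, with \<open>n\<close> the number of variables, to weight at least \<open>K + c\<close>. There one pure power
  can be split off, leaving weight at least \<open>K\<close>. So the ideal of weight \<open>K\<close>, generated by the
  finitely many monomials with exponents at most \<open>K\<close>, is a module to which the determinant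
  trick applies.
\<close>

lemma integral_closure_pure_powers:
  fixes w :: "'v::finite \<Rightarrow> nat"
  assumes "c > 0" and "\<And>i. w i * \<alpha> i = c"
  shows "integral_closure (ideal_generated {mvar i ^ \<alpha> i | i. True}) =
    (weight_ideal w c :: ('v, 'k::idom) mpoly set)" (is "integral_closure ?I = _")
proof
  have ideal: "is_ideal ?I" by (rule ring_ideal.subspace_span)
  have "?I \<subseteq> weight_ideal w c"
    by (rule ring_ideal.span_minimal)
      (auto simp: mvar_power assms(2) intro!: single_in_weight_ideal is_ideal_weight_ideal)
  then show "integral_closure ?I \<subseteq> weight_ideal w c"
    by (rule integral_closure_subset_weight_ideal)
  have w_pos: "w i > 0" for i
    using assms(1) assms(2)[of i] by (cases "w i = 0") auto
  define K where "K = c * CARD('v)"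
  define B where "B = {u. K \<le> weight w u \<and> (\<forall>i. Poly_Mapping.lookup u i \<le> K)}"
  have B: "finite B"
    by (rule finite_subset[OF _ finite_bounded_exponents[of K]]) (auto simp: B_def)
  let ?M = "{g :: ('v, 'k) mpoly. \<exists>A. (\<forall>b\<in>B. A b \<in> ?I) \<and> g = (\<Sum>b\<in>B. A b * monomial b)}"
  have M_ideal: "is_ideal ?M"
    unfolding ring_ideal.subspace_def
  proof (intro conjI ballI allI)
    show "0 \<in> ?M"
      using ring_ideal.subspace_0[OF ideal] by (intro CollectI exI[of _ "\<lambda>_. 0"]) simp
  next
    fix g h assume "g \<in> ?M" "h \<in> ?M"
    obtain A where "\<forall>b\<in>B. A b \<in> ?I" "g = (\<Sum>b\<in>B. A b * monomial b)"
      using \<open>g \<in> ?M\<close> by blast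
    moreover obtain A' where "\<forall>b\<in>B. A' b \<in> ?I" "h = (\<Sum>b\<in>B. A' b * monomial b)"
      using \<open>h \<in> ?M\<close> by blast
    ultimately show "g + h \<in> ?M"
      using ring_ideal.subspace_add[OF ideal]
      by (intro CollectI exI[of _ "\<lambda>b. A b + A' b"]) (auto simp: distrib_right sum.distrib)
  next
    fix r g assume "g \<in> ?M"
    then obtain A where "\<forall>b\<in>B. A b \<in> ?I" "g = (\<Sum>b\<in>B. A b * monomial b)" by blast
    then show "r * g \<in> ?M"
      using ideal_mult[OF ideal]
      by (intro CollectI exI[of _ "\<lambda>b. r * A b"]) (auto simp: sum_distrib_left mult.assoc)
  qed
  have M: "weight_ideal w (K + c) \<subseteq> ?M"
  proof (rule weight_ideal_subset[OF M_ideal])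
    fix u assume "K + c \<le> weight w u"
    then obtain i t where t: "u = Poly_Mapping.single i (\<alpha> i) + t" "K \<le> weight w t"
      unfolding K_def by (rule pure_power_divides[OF assms])
    obtain b r where b: "t = b + r" "K \<le> weight w b" "\<And>i. Poly_Mapping.lookup b i \<le> K"
      by (rule bounded_divisor_of_large_weight[OF w_pos t(2)]) blast
    have "mvar i ^ \<alpha> i \<in> ?I" by (rule ring_ideal.span_base) blast
    then have coeff: "monomial r * mvar i ^ \<alpha> i \<in> ?I" by (rule ideal_mult[OF ideal])
    have "b \<in> B" using b by (simp add: B_def)
    have "(\<Sum>b'\<in>B. (if b' = b then monomial r * mvar i ^ \<alpha> i else 0) * monomial b')
        = (\<Sum>b'\<in>B. if b' = b then monomial r * mvar i ^ \<alpha> i * monomial b else 0)"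
      by (rule sum.cong) auto
    also have "\<dots> = monomial r * mvar i ^ \<alpha> i * monomial b"
      using B \<open>b \<in> B\<close> by simp
    also have "\<dots> = monomial u"
      by (simp add: t(1) b(1) mvar_power mult_single ac_simps)
    finally have "monomial u = (\<Sum>b'\<in>B. (if b' = b then monomial r * mvar i ^ \<alpha> i else 0) * monomial b')"
      by (rule sym)
    moreover have "\<forall>b'\<in>B. (if b' = b then monomial r * mvar i ^ \<alpha> i else 0) \<in> ?I"
      using coeff ring_ideal.subspace_0[OF ideal] by simp
    ultimately show "monomial u \<in> ?M"
      by (intro CollectI exI[of _ "\<lambda>b'. if b' = b then monomial r * mvar i ^ \<alpha> i else 0"] conjI)
  qed
  show "weight_ideal w c \<subseteq> integral_closure ?I"
  proof
    fix f :: "('v, 'k) mpoly" assume f: "f \<in> weight_ideal w c"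
    fix i0 :: 'v
    have "Poly_Mapping.single i0 K \<in> B"
      using w_pos[of i0] by (simp add: B_def lookup_single when_def)
    then show "f \<in> integral_closure ?I"
    proof (rule integral_closure_if_stable_module[OF ideal B])
      show "y = 0" if "y * monomial (Poly_Mapping.single i0 K) = 0" for y :: "('v, 'k) mpoly"
        using that by (rule mult_monomial_eq_0)
      fix b assume "b \<in> B"
      then have "monomial b \<in> (weight_ideal w K :: ('v, 'k) mpoly set)"
        by (intro single_in_weight_ideal) (simp add: B_def)
      then have "f * monomial b \<in> weight_ideal w (K + c)"
        using weight_ideal_mult[OF f] by (simp add: add.commute)
      then show "\<exists>A. (\<forall>j\<in>B. A j \<in> ?I) \<and> f * monomial b = (\<Sum>j\<in>B. A j * monomial j)"
        using subsetD[OF M, of "f * monomial b"] by simp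
    qed
  qed
qed

section \<open>Normality for weights with two values\<close>

lemma exponent_splits_off_list:
  fixes u :: "'v \<Rightarrow>\<^sub>0 nat"
  assumes "d \<le> (\<Sum>i\<in>X. Poly_Mapping.lookup u i)"
  obtains xs t where "set xs \<subseteq> X" and "length xs = d"
    and "u = (\<Sum>i\<leftarrow>xs. Poly_Mapping.single i 1) + t"
proof -
  have "\<exists>xs t. set xs \<subseteq> X \<and> length xs = d \<and> u = (\<Sum>i\<leftarrow>xs. Poly_Mapping.single i 1) + t"
    using assms
  proof (induction d)
    case 0
    then show ?case by (intro exI[of _ "[]"] exI[of _ u]) simp
  next
    case (Suc d)
    then obtain xs t where xs: "set xs \<subseteq> X" "length xs = d"
      and u: "u = (\<Sum>i\<leftarrow>xs. Poly_Mapping.single i 1) + t"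
      by auto
    have X: "finite X" using Suc.prems by (cases "finite X") auto
    have "(\<Sum>i\<in>X. Poly_Mapping.lookup (\<Sum>j\<leftarrow>xs. Poly_Mapping.single j 1) i) = (length xs :: nat)"
      using xs(1) X
      by (induction xs) (simp_all add: lookup_add lookup_single when_def sum.distrib)
    then have "(\<Sum>i\<in>X. Poly_Mapping.lookup t i) \<noteq> 0"
      using Suc.prems xs(2) unfolding u by (simp add: lookup_add sum.distrib)
    then obtain i where "i \<in> X" "Poly_Mapping.lookup t i \<noteq> 0"
      by (metis sum.neutral)
    then obtain t' where "t = Poly_Mapping.single i 1 + t'"
      using exponent_split[of 1 t i] by auto
    then have "u = (\<Sum>i\<leftarrow>i # xs. Poly_Mapping.single i 1) + t'"
      unfolding u by (simp add: ac_simps)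
    then show ?case
      using xs \<open>i \<in> X\<close> by (intro exI[of _ "i # xs"] exI[of _ t']) simp
  qed
  then show thesis using that by blast
qed

lemma weight_sum_list: "weight w (\<Sum>i\<leftarrow>xs. Poly_Mapping.single (g i) 1) = (\<Sum>i\<leftarrow>xs. w (g i))"
  by (induction xs) (simp_all add: weight_add)

definition two_weight :: "'v set \<Rightarrow> nat \<Rightarrow> nat \<Rightarrow> 'v \<Rightarrow> nat" where
  "two_weight X s l i = (if i \<in> X then l else s)"

lemma weight_two_weight:
  "weight (two_weight X s l) u =
    l * (\<Sum>i\<in>X. Poly_Mapping.lookup u i) + s * (\<Sum>i\<in>-X. Poly_Mapping.lookup u i)"
proof -
  have "(UNIV :: 'a set) = X \<union> -X" by simp
  then have "weight (two_weight X s l) u = (\<Sum>i\<in>X \<union> -X. two_weight X s l i * Poly_Mapping.lookup u i)"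
    by (simp add: weight_def)
  also have "\<dots> = (\<Sum>i\<in>X. two_weight X s l i * Poly_Mapping.lookup u i)
      + (\<Sum>i\<in>-X. two_weight X s l i * Poly_Mapping.lookup u i)"
    by (rule sum.union_disjoint) auto
  also have "(\<Sum>i\<in>X. two_weight X s l i * Poly_Mapping.lookup u i) = l * (\<Sum>i\<in>X. Poly_Mapping.lookup u i)"
    by (simp add: two_weight_def sum_distrib_left)
  also have "(\<Sum>i\<in>-X. two_weight X s l i * Poly_Mapping.lookup u i) = s * (\<Sum>i\<in>-X. Poly_Mapping.lookup u i)"
    by (simp add: two_weight_def sum_distrib_left)
  finally show ?thesis .
qed

text \<open>
  A monomial of degree at least \<open>s\<close> in the variables of weight \<open>l\<close>, or of degree at least \<open>l\<close> in
  those of weight \<open>s\<close>, has a factor of weight exactly \<open>s * l\<close>, and splitting it off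
  wastes nothing. A monomial with neither property has weight below \<open>2 * s * l\<close>. This forces
  \<open>k = 0\<close>, and the trivial splitting will do.
\<close>

lemma two_weight_splits:
  fixes X :: "'v::finite set" and s l :: nat
  defines "w \<equiv> two_weight X s l"
  assumes "s > 0" and "l > 0" and u: "Suc k * (s * l) \<le> weight w u"
  obtains u1 u2 where "u = u1 + u2" and "s * l \<le> weight w u1" and "k * (s * l) \<le> weight w u2"
proof -
  note split = that
  have *: thesis if "d \<le> (\<Sum>i\<in>Z. Poly_Mapping.lookup u i)" "\<And>i. i \<in> Z \<Longrightarrow> w i = e" "d * e = s * l" for Z d e
  proof -
    obtain xs t where xs: "set xs \<subseteq> Z" "length xs = d" and t: "u = (\<Sum>i\<leftarrow>xs. Poly_Mapping.single i 1) + t"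
      using exponent_splits_off_list[OF \<open>d \<le> _\<close>] .
    have "(\<Sum>i\<leftarrow>xs. w i) = length xs * e"
      using xs(1) that(2) by (induction xs) auto
    then have "weight w (\<Sum>i\<leftarrow>xs. Poly_Mapping.single i 1) = s * l"
      using weight_sum_list[of w "\<lambda>i. i" xs] xs(2) that(3) by simp
    moreover from this have "k * (s * l) \<le> weight w t"
      using u unfolding t weight_add by simp
    ultimately show thesis using split[OF t] by simp
  qed
  let ?A = "\<Sum>i\<in>X. Poly_Mapping.lookup u i" and ?B = "\<Sum>i\<in>-X. Poly_Mapping.lookup u i"
  consider "s \<le> ?A" | "l \<le> ?B" | "?A < s" "?B < l" by linarith
  then show thesis
  proof cases
    case 1
    then show thesis by (rule *[of s X l]) (simp_all add: w_def two_weight_def)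
  next
    case 2
    then show thesis by (rule *[of l "-X" s]) (simp_all add: w_def two_weight_def mult.commute)
  next
    case 3
    have "weight w u = l * ?A + s * ?B" by (simp add: w_def weight_two_weight)
    also have "\<dots> < l * s + s * l"
      using 3 assms(2,3) by (intro add_strict_mono mult_strict_left_mono)
    finally have "weight w u < 2 * (s * l)" by (simp add: mult.commute)
    then have "Suc k * (s * l) < 2 * (s * l)" by (rule le_less_trans[OF u])
    then have "k = 0" by simp
    then show thesis using split[of u 0] u by simp
  qed
qed

lemma ideal_power_two_weight:
  fixes X :: "'v::finite set" and s l :: nat
  defines "w \<equiv> two_weight X s l"
  assumes "s > 0" and "l > 0"
  shows "ideal_power (weight_ideal w (s * l)) k = (weight_ideal w (k * (s * l)) :: ('v, 'k::comm_ring_1) mpoly set)"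
proof (induction k)
  case (Suc k)
  let ?P = "ideal_product (weight_ideal w (s * l)) (weight_ideal w (k * (s * l))) :: ('v, 'k) mpoly set"
  have "weight_ideal w (Suc k * (s * l)) \<subseteq> ?P"
  proof (rule weight_ideal_subset)
    show "is_ideal ?P" by (simp add: ideal_product_def ring_ideal.subspace_span)
    fix u assume "Suc k * (s * l) \<le> weight w u"
    then obtain u1 u2 where u: "u = u1 + u2" "s * l \<le> weight w u1" "k * (s * l) \<le> weight w u2"
      using two_weight_splits[OF assms(2,3), of k X u] unfolding w_def by blast
    then show "monomial u \<in> ?P"
      unfolding u(1) monomial_add by (intro mult_in_ideal_product single_in_weight_ideal)
  qed
  moreover have "?P \<subseteq> weight_ideal w (Suc k * (s * l))"
    using Suc ideal_power_subset_weight_ideal[of "weight_ideal w (s * l) :: ('v, 'k) mpoly set" w "s * l" "Suc k"] by simp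
  ultimately show ?case using Suc by simp
qed simp

lemma normal_two_weight:
  assumes "s > 0" and "l > 0"
  shows "normal_ideal (weight_ideal (two_weight X s l) (s * l) :: ('v::finite, 'k::idom) mpoly set)"
  unfolding normal_ideal_def
  by (simp add: is_ideal_weight_ideal ideal_power_two_weight[OF assms] integrally_closed_weight_ideal)

section \<open>The grouped generators\<close>

lemma lam_bounds:
  assumes "s > 0"
  shows "a * l \<le> s * lam s l a" and "a * l \<le> s * d \<Longrightarrow> lam s l a \<le> d"
proof -
  have "real (a * l) / real s \<le> real (lam s l a)"
    unfolding lam_def by (rule real_nat_ceiling_ge)
  then have "real (a * l) \<le> real (s * lam s l a)"
    using assms by (simp add: divide_le_eq mult.commute)
  then show "a * l \<le> s * lam s l a" by (simp only: of_nat_le_iff)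
  assume "a * l \<le> s * d"
  then have "real (a * l) \<le> real (s * d)" by (simp only: of_nat_le_iff)
  then have "real (a * l) / real s \<le> real d"
    using assms by (simp add: divide_le_eq mult.commute)
  then show "lam s l a \<le> d" unfolding lam_def by (simp add: ceiling_le_iff)
qed

lemma sum_list_sort: "(\<Sum>i\<leftarrow>sort xs. f i) = (\<Sum>i\<leftarrow>xs. f i :: 'b::comm_monoid_add)"
  by (metis mset_map mset_sort sum_mset_sum_list)

lemma exponent_splits_off_sorted_list:
  fixes u :: "'v \<Rightarrow>\<^sub>0 nat" and g :: "'a::linorder \<Rightarrow> 'v"
  assumes "d \<le> (\<Sum>i\<in>range g. Poly_Mapping.lookup u i)"
  obtains xs t where "sorted xs" and "length xs = d"
    and "u = (\<Sum>i\<leftarrow>xs. Poly_Mapping.single (g i) 1) + t"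
proof -
  obtain ys t where ys: "set ys \<subseteq> range g" "length ys = d"
    and t: "u = (\<Sum>i\<leftarrow>ys. Poly_Mapping.single i 1) + t"
    using exponent_splits_off_list[OF assms] .
  have "\<exists>xs. ys = map g xs"
    unfolding ex_map_conv using ys(1) by blast
  then obtain xs where xs: "ys = map g xs" ..
  have "(\<Sum>i\<leftarrow>ys. Poly_Mapping.single i (1::nat)) = (\<Sum>i\<leftarrow>sort xs. Poly_Mapping.single (g i) 1)"
    unfolding xs sum_list_sort by (simp add: comp_def)
  then show thesis
    using that[of "sort xs" t] t ys(2) xs by simp
qed

text \<open>
  Given a monomial of degree \<open>A\<close> in \<open>x\<close> and \<open>B\<close> in \<open>y\<close> with \<open>l * A + s * B \<ge> s * l\<close>, the generators
  with \<open>a = s - A\<close> (truncated at zero) are the right ones: the weight inequality says exactly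
  that the \<open>y\<close>-degree suffices.
\<close>

lemma grouped_ideal_eq_weight_ideal:
  assumes "s > 0"
  shows "(grouped_ideal s l :: ('m::{finite,linorder} + 'n::{finite,linorder}, 'k::comm_ring_1) mpoly set) =
    weight_ideal (two_weight (range Inl) s l) (s * l)" (is "_ = weight_ideal ?w _")
proof
  show "(grouped_ideal s l :: ('m + 'n, 'k) mpoly set) \<subseteq> weight_ideal ?w (s * l)"
    unfolding grouped_ideal_def
  proof (intro ring_ideal.span_minimal is_ideal_weight_ideal subsetI, elim CollectE exE conjE)
    fix f :: "('m + 'n, 'k) mpoly" and a "is" js
    assume f: "f = (\<Prod>i\<leftarrow>is. mvar (Inl i)) * (\<Prod>j\<leftarrow>js. mvar (Inr j))"
      and a: "a \<in> {0..s}" and len: "length is = s - a" "length js = lam s l a"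
    let ?x = "\<Sum>i\<leftarrow>is. Poly_Mapping.single (Inl i) 1" and ?y = "\<Sum>j\<leftarrow>js. Poly_Mapping.single (Inr j) 1"
    have "(\<Sum>i\<leftarrow>is. ?w (Inl i)) = length is * l" and "(\<Sum>j\<leftarrow>js. ?w (Inr j)) = length js * s"
      by (simp_all add: two_weight_def sum_list_triv image_iff)
    then have "weight ?w (?x + ?y) = (s - a) * l + lam s l a * s"
      by (simp only: weight_add weight_sum_list len)
    moreover have "s * l = (s - a) * l + a * l"
      using a by (simp add: add_mult_distrib[symmetric])
    ultimately have "s * l \<le> weight ?w (?x + ?y)"
      using lam_bounds(1)[OF assms, of a l] by (simp add: mult.commute)
    then show "f \<in> weight_ideal ?w (s * l)"
      unfolding f prod_list_mvar monomial_add[symmetric] by (rule single_in_weight_ideal)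
  qed
  have ideal: "is_ideal (grouped_ideal s l :: ('m + 'n, 'k) mpoly set)"
    unfolding grouped_ideal_def by (rule ring_ideal.subspace_span)
  show "weight_ideal ?w (s * l) \<subseteq> (grouped_ideal s l :: ('m + 'n, 'k) mpoly set)"
  proof (rule weight_ideal_subset[OF ideal])
    fix u :: "'m + 'n \<Rightarrow>\<^sub>0 nat" assume u: "s * l \<le> weight ?w u"
    define A B where "A = (\<Sum>i\<in>range (Inl :: 'm \<Rightarrow> 'm + 'n). Poly_Mapping.lookup u i)"
      and "B = (\<Sum>i\<in>range (Inr :: 'n \<Rightarrow> 'm + 'n). Poly_Mapping.lookup u i)"
    have "- range (Inl :: 'm \<Rightarrow> 'm + 'n) = range Inr"
      by (rule set_eqI, rename_tac x, case_tac x) auto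
    then have weight: "weight ?w u = l * A + s * B"
      by (simp add: weight_two_weight A_def B_def)
    define a where "a = s - A"
    have "s * l = (s - a) * l + a * l"
      unfolding a_def by (simp add: add_mult_distrib[symmetric])
    moreover have "a = 0 \<or> s - a = A" by (auto simp: a_def)
    ultimately have "a * l \<le> s * B"
      using u weight by (auto simp: mult.commute)
    then have "lam s l a \<le> B" by (rule lam_bounds(2)[OF assms])
    then obtain js t where js: "sorted js" "length js = lam s l a"
      and t: "u = (\<Sum>j\<leftarrow>js. Poly_Mapping.single (Inr j :: 'm + 'n) 1) + t"
      unfolding B_def by (rule exponent_splits_off_sorted_list)
    have "Poly_Mapping.lookup (\<Sum>j\<leftarrow>js. Poly_Mapping.single (Inr j :: 'm + 'n) 1) (Inl i) = (0::nat)" for i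
      by (induction js) (simp_all add: lookup_add lookup_single)
    then have "A = (\<Sum>i\<in>range (Inl :: 'm \<Rightarrow> 'm + 'n). Poly_Mapping.lookup t i)"
      unfolding A_def t by (intro sum.cong) (auto simp: lookup_add)
    then have "s - a \<le> (\<Sum>i\<in>range (Inl :: 'm \<Rightarrow> 'm + 'n). Poly_Mapping.lookup t i)"
      by (simp add: a_def)
    then obtain "is" r where "is": "sorted is" "length is = s - a"
      and r: "t = (\<Sum>i\<leftarrow>is. Poly_Mapping.single (Inl i :: 'm + 'n) 1) + r"
      by (rule exponent_splits_off_sorted_list)
    have "(\<Prod>i\<leftarrow>is. mvar (Inl i)) * (\<Prod>j\<leftarrow>js. mvar (Inr j)) \<in> (grouped_ideal s l :: ('m + 'n, 'k) mpoly set)"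
      unfolding grouped_ideal_def using js "is"
      by (intro ring_ideal.span_base CollectI exI[of _ a] exI[of _ "is"] exI[of _ js]) (simp add: a_def)
    then have "monomial r * ((\<Prod>i\<leftarrow>is. mvar (Inl i)) * (\<Prod>j\<leftarrow>js. mvar (Inr j)))
        \<in> (grouped_ideal s l :: ('m + 'n, 'k) mpoly set)"
      by (rule ideal_mult[OF ideal])
    moreover have "u = r + ((\<Sum>i\<leftarrow>is. Poly_Mapping.single (Inl i) 1) + (\<Sum>j\<leftarrow>js. Poly_Mapping.single (Inr j) 1))"
      unfolding t r by (simp add: ac_simps)
    ultimately show "monomial u \<in> (grouped_ideal s l :: ('m + 'n, 'k) mpoly set)"
      by (simp only: prod_list_mvar monomial_add)
  qed
qed

theorem theorem8:
  fixes s l :: nat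
  assumes "s > 0" and "l > 0"
  shows "(\<forall>\<alpha> :: 'v::finite \<Rightarrow> nat. (\<forall>i. \<alpha> i \<in> {s, l}) \<longrightarrow>
            normal_ideal (integral_closure
              (ideal_generated {mvar i ^ \<alpha> i | i. True} :: ('v, 'k::field) mpoly set)))
       \<and> (s \<le> l \<longrightarrow>
            normal_ideal
              (grouped_ideal s l :: ('m::{finite,linorder} + 'n::{finite,linorder}, 'k) mpoly set))"
proof (intro conjI allI impI)
  fix \<alpha> :: "'v \<Rightarrow> nat" assume \<alpha>: "\<forall>i. \<alpha> i \<in> {s, l}"
  let ?w = "two_weight {i. \<alpha> i = s} s l"
  have "?w i * \<alpha> i = s * l" for i
    using \<alpha> by (cases "\<alpha> i = s") (auto simp: two_weight_def)
  then have closure: "integral_closure (ideal_generated {mvar i ^ \<alpha> i | i. True}) =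
      (weight_ideal ?w (s * l) :: ('v, 'k) mpoly set)"
    using assms by (intro integral_closure_pure_powers) simp_all
  show "normal_ideal (integral_closure
      (ideal_generated {mvar i ^ \<alpha> i | i. True} :: ('v, 'k) mpoly set))"
    unfolding closure by (rule normal_two_weight[OF assms])
next
  show "normal_ideal (grouped_ideal s l :: ('m + 'n, 'k) mpoly set)"
    unfolding grouped_ideal_eq_weight_ideal[OF assms(1)] by (rule normal_two_weight[OF assms])
qed

end
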